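(* Let $k_2>0$. Let $x$ be a point in the interior of $C_N^B$, and let $y\in \mathbb R^N$. Let $k_0\ge 1/2$ be large enough that $\sqrt{k_1} \cdot x+y$ is in the interior of $C_N^B$ for all $k_1\ge k_0$. For $k_1\ge k_0$ let $(X_{t,k})_{t\ge0}$ be the Bessel process of type $B_N$ with multiplicities $k=(k_1,k_2)$ started at $\sqrt{k_1}\cdot x+y$. Put \[\phi(t,x)=\Bigl(\sqrt{2t+x_{1}^2}, \ldots,\sqrt{2t+x_{N}^2}\Bigr).\] Then, for all $t>0$, \[\sup_{0\le s\le t,\; k_1\ge k_0}\|X_{s,(k_1,k_2)}- \sqrt{k_1}\, \phi(s,x) \|<\infty \quad\text{almost surely.}\] In particular, $X_{t,(k_1,k_2)}/\sqrt{k_1} \to \phi(t,x)$ for $k_1\to\infty$ locally uniformly in $t$ almost surely, and thus locally uniformly in $t$ in probability.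
   Context: $C_N^B:=\{x\in \mathbb R^N: x_1\ge x_2\ge\ldots\ge x_N\ge0\}$; $\|\cdot\|$ is the Euclidean norm. $(B_t)_{t\ge0}=(B_t^1,\ldots,B_t^N)_{t\ge0}$ is an $N$-dimensional Brownian motion started at $0$ on some probability space. For $k=(k_1,k_2)$ with $k_1,k_2>0$, the Bessel process $(X_{t,k})_{t\ge0}$ of type $B_N$ is the unique strong solution (continuous, $C_N^B$-valued, with drift integrable on compact time intervals) with the given starting point of \[ dX_{t,k}^i = dB_t^i+ k_2\sum_{j\ne i} \Bigl(\frac{1}{X_{t,k}^i-X_{t,k}^j} + \frac{1}{X_{t,k}^i+X_{t,k}^j}\Bigr) dt + \frac{k_1}{X_{t,k}^i}\, dt \qquad(i=1,\ldots,N).\] Here $k_2$ is fixed, the same Brownian motion is used for all $k_1\ge k_0$, and the SDE in integrated form is understood to hold for all $k_1\ge k_0$ simultaneously outside one common null set. *)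

theory Defs
  imports "HOL-Probability.Probability"
begin

text \<open>The index type \<^typ>\<open>'n\<close> is a finite linear order; its increasing enumeration plays the role
  of \<open>1, \<dots>, N\<close>.\<close>

definition weyl_chamber_B :: "(real ^ ('n::{finite,linorder})) set" where
  "weyl_chamber_B = {x. (\<forall>i j. i \<le> j \<longrightarrow> x $ j \<le> x $ i) \<and> (\<forall>i. 0 \<le> x $ i)}"

definition brownian_motion_1d :: "'w measure \<Rightarrow> (real \<Rightarrow> 'w \<Rightarrow> real) \<Rightarrow> bool" where
  "brownian_motion_1d M W \<longleftrightarrow>
     (\<forall>t\<ge>0. W t \<in> borel_measurable M) \<and>
     (AE \<omega> in M. W 0 \<omega> = 0) \<and>
     (AE \<omega> in M. continuous_on {0..} (\<lambda>t. W t \<omega>)) \<and>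
     (\<forall>s t. 0 \<le> s \<and> s < t \<longrightarrow>
        distributed M lborel (\<lambda>\<omega>. W t \<omega> - W s \<omega>)
          (\<lambda>z. ennreal (normal_density 0 (sqrt (t - s)) z))) \<and>
     (\<forall>n (t :: nat \<Rightarrow> real). 0 \<le> t 0 \<and> (\<forall>i<n. t i < t (Suc i)) \<longrightarrow>
        prob_space.indep_vars M (\<lambda>_. borel) (\<lambda>i \<omega>. W (t (Suc i)) \<omega> - W (t i) \<omega>) {..<n})"

definition brownian_motion :: "'w measure \<Rightarrow> (real \<Rightarrow> 'w \<Rightarrow> real ^ 'n) \<Rightarrow> bool" where
  "brownian_motion M B \<longleftrightarrow>
     (\<forall>i. brownian_motion_1d M (\<lambda>t \<omega>. B t \<omega> $ i)) \<and>
     prob_space.indep_vars M (\<lambda>_. PiM {0..} (\<lambda>_. borel))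
       (\<lambda>i \<omega>. \<lambda>t\<in>{0..}. B t \<omega> $ i) UNIV"

definition augmented_filtration :: "'w measure \<Rightarrow> (real \<Rightarrow> 'w \<Rightarrow> real ^ 'n) \<Rightarrow> real \<Rightarrow> 'w measure" where
  "augmented_filtration M B t =
     sigma (space M)
       ((\<Union>s\<in>{0..t}. sets (vimage_algebra (space M) (B s) borel)) \<union> null_sets (completion M))"

definition bessel_drift_B :: "real \<Rightarrow> real \<Rightarrow> real ^ 'n \<Rightarrow> real ^ 'n" where
  "bessel_drift_B k\<^sub>1 k\<^sub>2 x =
     (\<chi> i. k\<^sub>2 * (\<Sum>j\<in>UNIV - {i}. 1 / (x $ i - x $ j) + 1 / (x $ i + x $ j)) + k\<^sub>1 / x $ i)"

text \<open>The drift is singular on the boundary of the chamber, whereas division by zero yields zero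
  here. Integrability of the drift implies mathematically that the path is in the interior at
  almost every time; this has to be required separately.\<close>

definition bessel_path_B ::
  "real \<Rightarrow> real \<Rightarrow> real ^ ('n::{finite,linorder}) \<Rightarrow> (real \<Rightarrow> real ^ ('n::{finite,linorder})) \<Rightarrow> (real \<Rightarrow> real ^ ('n::{finite,linorder})) \<Rightarrow> bool" where
  "bessel_path_B k\<^sub>1 k\<^sub>2 x0 b X \<longleftrightarrow>
     X 0 = x0 \<and>
     continuous_on {0..} X \<and>
     (\<forall>t\<ge>0. X t \<in> weyl_chamber_B) \<and>
     (AE t in lborel. 0 \<le> t \<longrightarrow> X t \<in> interior weyl_chamber_B) \<and>
     (\<forall>t\<ge>0. set_integrable lborel {0..t} (\<lambda>s. bessel_drift_B k\<^sub>1 k\<^sub>2 (X s))) \<and>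
     (\<forall>t\<ge>0. X t = X 0 + b t + (LINT s:{0..t}|lborel. bessel_drift_B k\<^sub>1 k\<^sub>2 (X s)))"

text \<open>\<open>X k\<^sub>1 t \<omega>\<close> is the state at time \<open>t\<close> of the process with multiplicities \<open>(k\<^sub>1, k\<^sub>2)\<close>, started
  at \<open>x0 k\<^sub>1\<close>. The exceptional null set for the equations is common to all \<open>k\<^sub>1 \<in> K\<close>; adaptedness
  to the augmented filtration of \<open>B\<close> makes each member a strong solution.\<close>

definition bessel_family_B ::
  "'w measure \<Rightarrow> (real \<Rightarrow> 'w \<Rightarrow> real ^ ('n::{finite,linorder})) \<Rightarrow> real \<Rightarrow> real set \<Rightarrow>
     (real \<Rightarrow> real ^ ('n::{finite,linorder})) \<Rightarrow> (real \<Rightarrow> real \<Rightarrow> 'w \<Rightarrow> real ^ ('n::{finite,linorder})) \<Rightarrow> bool" where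
  "bessel_family_B M B k\<^sub>2 K x0 X \<longleftrightarrow>
     (\<forall>k\<^sub>1\<in>K. \<forall>t\<ge>0. X k\<^sub>1 t \<in> borel_measurable (augmented_filtration M B t)) \<and>
     (AE \<omega> in M. \<forall>k\<^sub>1\<in>K. bessel_path_B k\<^sub>1 k\<^sub>2 (x0 k\<^sub>1) (\<lambda>t. B t \<omega>) (\<lambda>t. X k\<^sub>1 t \<omega>))"

definition \<phi>_B :: "real \<Rightarrow> real ^ 'n \<Rightarrow> real ^ 'n" where
  "\<phi>_B t x = (\<chi> i. sqrt (2 * t + (x $ i)\<^sup>2))"

text \<open>Since paths are only almost surely continuous, the deviation events are in general only
  measurable for the completion. Their measurability is part of the definition, as
  \<^const>\<open>measure\<close> vanishes on non-measurable sets.\<close>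

definition locally_uniformly_in_prob ::
  "'w measure \<Rightarrow> (real \<Rightarrow> real \<Rightarrow> 'w \<Rightarrow> real ^ 'n) \<Rightarrow> (real \<Rightarrow> real ^ 'n) \<Rightarrow> bool" where
  "locally_uniformly_in_prob M Y f \<longleftrightarrow>
     (\<forall>T>0. \<forall>\<epsilon>>0.
        let D = (\<lambda>k. {\<omega> \<in> space M. (SUP s\<in>{0..T}. ereal (norm (Y k s \<omega> - f s))) > ereal \<epsilon>})
        in (\<forall>\<^sub>F k in at_top. D k \<in> sets (completion M)) \<and>
           ((\<lambda>k. measure (completion M) (D k)) \<longlongrightarrow> 0) at_top)"

end

theory Submission
  imports Defs
begin

text \<open>The argument is pathwise. Fix \<open>T\<close> and a continuous path \<open>b\<close>, and choose a vector \<open>v\<close> so deep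
  in the chamber that \<open>w s = b s + v\<close> stays in the chamber for \<open>s \<le> T\<close>. Since \<open>\<phi>' = 1 / \<phi>\<close>, the
  difference \<open>E = X - sqrt k * \<phi> - w\<close> is absolutely continuous, and \<open>g \<bullet> E\<close> for its derivative \<open>g\<close>
  is bounded independently of \<open>k\<close>. Indeed the interaction part \<open>A\<close> of the drift satisfies
  \<open>\<xi> \<bullet> A \<xi> = N * (N - 1)\<close> and \<open>u \<bullet> A \<xi> \<ge> 0\<close> for every \<open>u\<close> in the chamber, in particular for
  \<open>u = sqrt k * \<phi> + w\<close>; the remaining part is monotone and contributes at most \<open>w i ^ 2 / \<phi> i ^ 2\<close>
  in the \<open>i\<close>-th coordinate. Hence \<open>E\<close> is bounded on \<open>[0, T]\<close> uniformly in \<open>k\<close>.\<close>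

section \<open>An energy estimate for integrals of merely integrable functions\<close>

lemma set_integral_diff_Icc:
  fixes g :: "real \<Rightarrow> 'a::euclidean_space"
  assumes "set_integrable lborel {0..t} g" "0 \<le> s" "s \<le> t"
  shows "(LINT u:{0..t}|lborel. g u) - (LINT u:{0..s}|lborel. g u) = (LINT u:{s<..t}|lborel. g u)"
proof -
  have "{0..t} = {0..s} \<union> {s<..t}" using assms by auto
  moreover have "set_integrable lborel {0..s} g" "set_integrable lborel {s<..t} g"
    by (rule set_integrable_subset[OF assms(1)]; use assms in auto)+
  ultimately have "(LINT u:{0..t}|lborel. g u) = (LINT u:{0..s}|lborel. g u) + (LINT u:{s<..t}|lborel. g u)"
    using set_integral_Un[of "{0..s}" "{s<..t}" lborel g] by (auto simp: disjoint_iff)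
  then show ?thesis by simp
qed

text \<open>As \<open>g\<close> is merely integrable there is no chain rule for \<open>(norm (E t))\<^sup>2\<close> at hand. Instead, on a
  fine mesh its increments \<open>(E t - E s) \<bullet> (E t + E s)\<close> are compared with the integral of
  \<open>2 * (g \<bullet> E)\<close>, up to \<open>e\<close> times that of \<open>norm g\<close>.\<close>

lemma norm_square_le_of_inner_deriv_le:
  fixes E g :: "real \<Rightarrow> 'a::euclidean_space"
  assumes T: "0 \<le> T"
    and int: "set_integrable lborel {0..T} g"
    and E: "\<And>t. t \<in> {0..T} \<Longrightarrow> E t = E 0 + (LINT s:{0..t}|lborel. g s)"
    and cont: "continuous_on {0..T} E"
    and C: "AE s in lborel. s \<in> {0..T} \<longrightarrow> g s \<bullet> E s \<le> C"
  shows "(norm (E T))\<^sup>2 \<le> (norm (E 0))\<^sup>2 + 2 * C * T"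
proof -
  define H where "H t = (LINT s:{0..t}|lborel. norm (g s))" for t
  have Hint: "set_integrable lborel {0..T} (\<lambda>s. norm (g s))"
    by (rule set_integrable_norm[OF int])
  have main: "(norm (E T))\<^sup>2 \<le> (norm (E 0))\<^sup>2 + 2 * C * T + e * H T" if e: "e > 0" for e
  proof -
    \<comment> \<open>The tolerance \<open>e / 2\<close> is chosen because \<open>E t + E s\<close>
      differs from \<open>2 *\<^sub>R E u\<close> by two such increments, hence by at most
      \<open>e\<close>.\<close>
    have "uniformly_continuous_on {0..T} E"
      using cont by (intro compact_uniformly_continuous) auto
    then obtain d where d: "d > 0"
      "\<And>u v. u \<in> {0..T} \<Longrightarrow> v \<in> {0..T} \<Longrightarrow> dist u v < d \<Longrightarrow> dist (E u) (E v) < e / 2"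
      using e unfolding uniformly_continuous_on_def by (metis half_gt_zero)
    \<comment> \<open>\<open>P\<close> subtracts from the squared norm its permitted growth and the
      accumulated mesh error. It does not increase over any step shorter than
      \<open>d\<close>.\<close>
    define P where "P t = (norm (E t))\<^sup>2 - 2 * C * t - e * H t" for t
    have step: "P t \<le> P s" if st: "0 \<le> s" "s \<le> t" "t \<le> T" "t - s < d" for s t
    proof -
      have sub: "set_integrable lborel {s<..t} g" "set_integrable lborel {s<..t} (\<lambda>u. norm (g u))"
        by (rule set_integrable_subset[OF int] set_integrable_subset[OF Hint]; use st in auto)+
      have t0: "set_integrable lborel {0..t} g" "set_integrable lborel {0..t} (\<lambda>u. norm (g u))"
        by (rule set_integrable_subset[OF int] set_integrable_subset[OF Hint]; use st in auto)+
      have "E t - E s = (LINT u:{s<..t}|lborel. g u)"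
        using E[of t] E[of s] set_integral_diff_Icc[OF t0(1)] st by auto
      have "(norm (E t))\<^sup>2 - (norm (E s))\<^sup>2 = (E t - E s) \<bullet> (E t + E s)"
        by (simp add: power2_norm_eq_inner inner_diff_left inner_add_right inner_commute[of "E s" "E t"])
      also have "\<dots> = (LINT u:{s<..t}|lborel. g u \<bullet> (E t + E s))"
        using sub(1) unfolding \<open>E t - E s = _\<close> set_lebesgue_integral_def set_integrable_def
        by (subst integral_inner_left[symmetric]) auto
      also have "\<dots> \<le> (LINT u:{s<..t}|lborel. 2 * C + e * norm (g u))"
      proof (rule set_integral_mono_AE)
        show "set_integrable lborel {s<..t} (\<lambda>u. g u \<bullet> (E t + E s))"
          using sub(1) unfolding set_integrable_def
          using integrable_inner_left[of "E t + E s" lborel "\<lambda>x. indicator {s<..t} x *\<^sub>R g x"] by auto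
        show "set_integrable lborel {s<..t} (\<lambda>u. 2 * C + e * norm (g u))"
          using sub(2) st
          by (intro set_integral_add set_integrable_mult_right) (auto simp: set_integrable_def)
        show "AE u\<in>{s<..t} in lborel. g u \<bullet> (E t + E s) \<le> 2 * C + e * norm (g u)"
          using C
        proof eventually_elim
          case (elim u)
          show ?case
          proof
            assume u: "u \<in> {s<..t}"
            then have "g u \<bullet> E u \<le> C" using elim st by auto
            moreover have "norm (E t - E u) \<le> e / 2" "norm (E s - E u) \<le> e / 2"
              using d(2)[of t u] d(2)[of s u] u st by (auto simp: dist_norm)
            then have "norm ((E t - E u) + (E s - E u)) \<le> e"
              using norm_triangle_ineq[of "E t - E u" "E s - E u"] by linarith
            then have "g u \<bullet> ((E t - E u) + (E s - E u)) \<le> norm (g u) * e"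
              by (meson Cauchy_Schwarz_ineq2 abs_le_D1 mult_left_mono norm_ge_zero order_trans)
            ultimately show "g u \<bullet> (E t + E s) \<le> 2 * C + e * norm (g u)"
              by (simp add: inner_add_right inner_diff_right algebra_simps)
          qed
        qed
      qed
      also have "\<dots> = 2 * C * (t - s) + e * (H t - H s)"
      proof -
        have "(LINT u:{s<..t}|lborel. 2 * C) = 2 * C * (t - s)"
          using st by (simp add: set_lebesgue_integral_def)
        moreover have "set_integrable lborel {s<..t} (\<lambda>u. 2 * C)"
          using st by (simp add: set_integrable_def)
        moreover have "set_integrable lborel {s<..t} (\<lambda>u. e * norm (g u))"
          using sub(2) by (rule set_integrable_mult_right)
        ultimately show ?thesis
          unfolding H_def using set_integral_diff_Icc[OF t0(2), of s] st
          by (simp add: set_integral_add)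
      qed
      finally show ?thesis unfolding P_def by (simp add: algebra_simps)
    qed
    \<comment> \<open>The interval is cut into \<open>n\<close> equal steps shorter than
      \<open>d\<close>; the strict inequality forces \<open>n > 0\<close> even when
      \<open>T = 0\<close>.\<close>
    obtain n :: nat where n: "T / d < real n" using reals_Archimedean2 by blast
    have npos: "0 < real n" using n T d by (meson divide_nonneg_pos le_less_trans)
    have mesh: "T / real n < d" using n d npos by (simp add: field_simps)
    have "P (T * real i / real n) \<le> P 0" if "i \<le> n" for i
      using that
    proof (induction i)
      case (Suc i)
      have "P (T * real (Suc i) / real n) \<le> P (T * real i / real n)"
      proof (rule step)
        show "0 \<le> T * real i / real n" using T by simp
        show "T * real i / real n \<le> T * real (Suc i) / real n"
          using T by (intro divide_right_mono mult_left_mono) auto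
        show "T * real (Suc i) / real n \<le> T"
          using Suc.prems npos T mult_left_mono[of "real (Suc i)" "real n" T] by (simp add: field_simps)
        have "T * real (Suc i) / real n - T * real i / real n = T / real n"
          by (simp add: distrib_left add_divide_distrib)
        then show "T * real (Suc i) / real n - T * real i / real n < d" using mesh by simp
      qed
      with Suc show ?case by simp
    qed simp
    from this[of n] have "P T \<le> P 0" using npos by simp
    moreover have "H 0 \<ge> 0" unfolding H_def set_lebesgue_integral_def by (intro integral_nonneg_AE) auto
    then have "0 \<le> e * H 0" using e by simp
    ultimately show ?thesis unfolding P_def by simp
  qed
  \<comment> \<open>Only \<open>d\<close> and the mesh depend on \<open>e\<close>, while
    \<open>H T\<close> is a fixed real number, so the error vanishes as \<open>e\<close> tends to 0
    from the right.\<close>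
  have "((\<lambda>e. (norm (E 0))\<^sup>2 + 2 * C * T + e * H T) \<longlongrightarrow> (norm (E 0))\<^sup>2 + 2 * C * T + 0 * H T) (at_right 0)"
    by (intro tendsto_intros)
  moreover have "\<forall>\<^sub>F e in at_right 0. (norm (E T))\<^sup>2 \<le> (norm (E 0))\<^sup>2 + 2 * C * T + e * H T"
    using eventually_at_right_less[of "0 :: real"] by eventually_elim (rule main)
  ultimately have "(norm (E T))\<^sup>2 \<le> (norm (E 0))\<^sup>2 + 2 * C * T + 0 * H T"
    by (rule tendsto_lowerbound) simp
  then show ?thesis by simp
qed

section \<open>Geometry of the chamber\<close>

text \<open>A small ball around an interior point lies in the chamber. Lowering the single
  coordinate \<open>i\<close> by \<open>e > 0\<close> therefore preserves the weak inequalities,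
  which makes the original ones strict.\<close>

lemma interior_weyl_chamber_B:
  fixes x :: "real ^ 'n::{finite,linorder}"
  assumes "x \<in> interior weyl_chamber_B"
  shows "i < j \<Longrightarrow> x $ j < x $ i" and "0 < x $ i"
proof -
  obtain e where e: "e > 0" "cball x e \<subseteq> weyl_chamber_B"
    using assms mem_interior_cball by blast
  have in_ch: "x - e *\<^sub>R axis l 1 \<in> weyl_chamber_B" for l
    using e by (intro subsetD[OF e(2)]) (simp add: dist_norm norm_axis_1)
  show "0 < x $ i"
    using in_ch[of i] e(1) unfolding weyl_chamber_B_def by (auto dest!: spec[of _ i] simp: axis_def)
  show "x $ j < x $ i" if "i < j"
  proof -
    have "(x - e *\<^sub>R axis i 1) $ j \<le> (x - e *\<^sub>R axis i 1) $ i"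
      using in_ch[of i] less_imp_le[OF that] unfolding weyl_chamber_B_def mem_Collect_eq by blast
    then show ?thesis using e(1) less_imp_neq[OF that] by (simp add: axis_def)
  qed
qed

lemma weyl_chamber_B_add:
  "u \<in> weyl_chamber_B \<Longrightarrow> w \<in> weyl_chamber_B \<Longrightarrow> u + w \<in> weyl_chamber_B"
  by (auto simp: weyl_chamber_B_def intro: add_mono)

lemma weyl_chamber_B_scaleR:
  "0 \<le> c \<Longrightarrow> w \<in> weyl_chamber_B \<Longrightarrow> c *\<^sub>R w \<in> weyl_chamber_B"
  by (auto simp: weyl_chamber_B_def intro: mult_left_mono)

lemma \<phi>_B_in_weyl_chamber:
  assumes "x \<in> weyl_chamber_B" "0 \<le> t"
  shows "\<phi>_B t x \<in> weyl_chamber_B"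
  using assms by (auto simp: weyl_chamber_B_def \<phi>_B_def power_mono)

text \<open>The chamber is a cone: scaling a ball of radius \<open>e\<close> around \<open>x\<close>
  by \<open>R\<close> gives a ball of radius \<open>R * e\<close> around
  \<open>R *\<^sub>R x\<close> inside the chamber. The shift serves to push a bounded driving path
  into the chamber.\<close>

lemma bounded_plus_chamber:
  fixes x :: "real ^ 'n::{finite,linorder}"
  assumes "x \<in> interior weyl_chamber_B"
  obtains R where "\<And>u. norm u \<le> \<beta> \<Longrightarrow> u + R *\<^sub>R x \<in> weyl_chamber_B"
proof -
  obtain e where e: "e > 0" "cball x e \<subseteq> weyl_chamber_B"
    using assms mem_interior_cball by blast
  \<comment> \<open>The summand 1 keeps \<open>R\<close> positive, also for
    \<open>\<beta> \<le> 0\<close>, so that division by \<open>R\<close> is legitimate.\<close>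
  define R where "R = (\<bar>\<beta>\<bar> + 1) / e"
  have R: "R > 0" using e by (simp add: R_def add_nonneg_pos)
  have "u + R *\<^sub>R x \<in> weyl_chamber_B" if "norm u \<le> \<beta>" for u
  proof -
    have "norm u \<le> R * e" using that e by (simp add: R_def)
    then have "x + (1 / R) *\<^sub>R u \<in> cball x e"
      using R by (simp add: dist_norm field_simps)
    then have "R *\<^sub>R (x + (1 / R) *\<^sub>R u) \<in> weyl_chamber_B"
      using e R by (intro weyl_chamber_B_scaleR) auto
    then show ?thesis using R by (simp add: algebra_simps)
  qed
  then show thesis by (rule that)
qed

section \<open>One-sided bounds for the drift, uniform in the multiplicity\<close>

text \<open>Symmetrization removes the singularities: the terms for \<open>(i, j)\<close> and
  \<open>(j, i)\<close> add up to two quotients of the form \<open>(a - c) / a\<close> with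
  \<open>a > 0\<close> and \<open>c \<ge> 0\<close>, where \<open>a\<close> is the difference or the
  sum of two coordinates of \<open>x\<close> and \<open>c\<close> that of \<open>w\<close>. Each
  quotient is at most 1.\<close>

lemma inner_interaction_le:
  fixes x w :: "real ^ 'n::{finite,linorder}"
  assumes x: "x \<in> interior weyl_chamber_B" and w: "w \<in> weyl_chamber_B"
  shows "(\<Sum>i\<in>UNIV. (x $ i - w $ i) * (\<Sum>j\<in>UNIV - {i}. 1 / (x $ i - x $ j) + 1 / (x $ i + x $ j)))
    \<le> (real CARD('n))\<^sup>2" (is "?S \<le> _")
proof -
  \<comment> \<open>The zero diagonal lets both indices run over all of \<open>UNIV\<close>, so that
    the double sum can be swapped. Without it the summand \<open>1 / (x $ i + x $ i)\<close> would
    survive.\<close>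
  define f where "f i j = (if i = j then 0 else 
    (x $ i - w $ i) * (1 / (x $ i - x $ j) + 1 / (x $ i + x $ j)))" for i j
  have S: "?S = (\<Sum>i\<in>UNIV. \<Sum>j\<in>UNIV. f i j)"
  proof (rule sum.cong[OF refl])
    fix i :: 'n
    have "(\<Sum>j\<in>UNIV. f i j) = (\<Sum>j\<in>UNIV - {i}. f i j)"
      by (rule sum.mono_neutral_right) (auto simp: f_def)
    also have "\<dots> = (\<Sum>j\<in>UNIV - {i}. (x $ i - w $ i) * (1 / (x $ i - x $ j) + 1 / (x $ i + x $ j)))"
      by (rule sum.cong) (auto simp: f_def)
    finally show "(x $ i - w $ i) * (\<Sum>j\<in>UNIV - {i}. 1 / (x $ i - x $ j) + 1 / (x $ i + x $ j))
       = (\<Sum>j\<in>UNIV. f i j)" by (simp add: sum_distrib_left)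
  qed
  have pair: "f i j + f j i \<le> 2" if "i < j" for i j
  proof -
    have pos: "x $ i - x $ j > 0" "x $ i + x $ j > 0"
      using interior_weyl_chamber_B[OF x] that by (auto intro: add_pos_pos)
    have wpos: "w $ i - w $ j \<ge> 0" "w $ i + w $ j \<ge> 0"
      using w that by (auto simp: weyl_chamber_B_def)
    have eq: "1 / (x $ j - x $ i) = - (1 / (x $ i - x $ j))"
      using pos by (simp add: field_simps)
    have alg: "(a - c) * (p + q) + (b - d) * (- p + q) = ((a - b) - (c - d)) * p + ((a + b) - (c + d)) * q"
      for a b c d p q :: real
      by (simp add: algebra_simps)
    have "f i j + f j i = ((x $ i - x $ j) - (w $ i - w $ j)) * (1 / (x $ i - x $ j))
       + ((x $ i + x $ j) - (w $ i + w $ j)) * (1 / (x $ i + x $ j))"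
      using alg[of "x $ i" "w $ i" "1 / (x $ i - x $ j)" "1 / (x $ i + x $ j)" "x $ j" "w $ j"]
        less_imp_neq[OF that]
      unfolding f_def eq add.commute[of "x $ j" "x $ i"] by simp
    also have "\<dots> \<le> 1 + 1"
      using pos wpos by (intro add_mono) auto
    finally show ?thesis by simp
  qed
  have "f i j + f j i \<le> 2" for i j
    using pair[of i j] pair[of j i] by (cases i j rule: linorder_cases) (auto simp: f_def)
  then have "(\<Sum>i\<in>UNIV. \<Sum>j\<in>UNIV. f i j + f j i) \<le> (\<Sum>i\<in>(UNIV::'n set). \<Sum>j\<in>(UNIV::'n set). 2)"
    by (intro sum_mono) auto
  also have "\<dots> = 2 * (real CARD('n))\<^sup>2" by (simp add: power2_eq_square)
  also have "(\<Sum>i\<in>UNIV. \<Sum>j\<in>UNIV. f i j + f j i) = ?S + ?S"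
    unfolding S using sum.swap[of "\<lambda>i j. f j i" UNIV UNIV] by (simp add: sum.distrib)
  finally show ?thesis by simp
qed

text \<open>With \<open>\<psi> = sqrt k * \<phi>\<close> and \<open>d = \<xi> - \<psi>\<close> the
  product equals \<open>k * (w - d) * d / (\<xi> * \<psi>)\<close>. It is positive only for
  \<open>0 < d < w\<close>; then both factors are at most \<open>w\<close> and
  \<open>\<xi> > \<psi>\<close>, so it is at most \<open>k * w\<^sup>2 / \<psi>\<^sup>2\<close>,
  from which \<open>k\<close> cancels.\<close>

lemma reciprocal_term_le:
  fixes k :: real
  assumes "0 < k" "0 < \<xi>" "0 < \<phi>" "0 \<le> w"
  shows "(\<xi> - sqrt k * \<phi> - w) * (k / \<xi> - sqrt k / \<phi>) \<le> w\<^sup>2 / \<phi>\<^sup>2"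
proof -
  define \<psi> where "\<psi> = sqrt k * \<phi>"
  have \<psi>: "\<psi> > 0" using assms by (simp add: \<psi>_def)
  have kk: "sqrt k / \<phi> = k / \<psi>"
    using assms by (simp add: \<psi>_def field_simps)
  have eq: "(\<xi> - \<psi> - w) * (k / \<xi> - k / \<psi>) = k * (w - (\<xi> - \<psi>)) * (\<xi> - \<psi>) / (\<xi> * \<psi>)"
    using assms \<psi> by (simp add: field_simps)
  show ?thesis
  proof (cases "\<psi> < \<xi> \<and> \<xi> < \<psi> + w")
    case True
    have "k * (w - (\<xi> - \<psi>)) * (\<xi> - \<psi>) / (\<xi> * \<psi>) \<le> k * w * w / (\<psi> * \<psi>)"
      using True assms \<psi> by (intro frac_le mult_mono mult_nonneg_nonneg) auto
    also have "\<dots> = w\<^sup>2 / \<phi>\<^sup>2"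
      using assms by (simp add: \<psi>_def power2_eq_square field_simps)
    finally show ?thesis using eq kk by (simp add: \<psi>_def)
  next
    case False
    then have "(w - (\<xi> - \<psi>)) * (\<xi> - \<psi>) \<le> 0"
      using assms by (auto simp: mult_le_0_iff)
    then have "k * (w - (\<xi> - \<psi>)) * (\<xi> - \<psi>) / (\<xi> * \<psi>) \<le> 0"
      using assms \<psi> by (simp add: divide_le_0_iff mult.assoc mult_le_0_iff)
    also have "0 \<le> w\<^sup>2 / \<phi>\<^sup>2" by simp
    finally show ?thesis using eq kk by (simp add: \<psi>_def)
  qed
qed

text \<open>The interaction bound is applied to the chamber vector
  \<open>sqrt k *\<^sub>R \<phi>_B s x + w\<close>, the reciprocal bound to each coordinate. Since
  the coordinates of \<open>\<phi>_B s x\<close> are at least those of \<open>x\<close>, the result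
  depends neither on \<open>k\<close> nor on \<open>s\<close>.\<close>

lemma inner_bessel_drift_le:
  fixes x \<xi> w :: "real ^ 'n::{finite,linorder}"
  assumes k: "0 < k" "0 < k\<^sub>2" and \<xi>: "\<xi> \<in> interior weyl_chamber_B"
    and x: "x \<in> interior weyl_chamber_B" and s: "0 \<le> s"
    and w: "w \<in> weyl_chamber_B" "norm w \<le> \<gamma>"
  shows "(bessel_drift_B k k\<^sub>2 \<xi> - (\<chi> i. sqrt k / \<phi>_B s x $ i)) \<bullet> (\<xi> - sqrt k *\<^sub>R \<phi>_B s x - w)
    \<le> k\<^sub>2 * (real CARD('n))\<^sup>2 + (\<Sum>i\<in>UNIV. \<gamma>\<^sup>2 / (x $ i)\<^sup>2)"
proof -
  let ?p = "\<phi>_B s x" and ?w = "sqrt k *\<^sub>R \<phi>_B s x + w"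
  let ?A = "\<lambda>i. \<Sum>j\<in>UNIV - {i}. 1 / (\<xi> $ i - \<xi> $ j) + 1 / (\<xi> $ i + \<xi> $ j)"
  have xch: "x \<in> weyl_chamber_B" using x interior_subset by blast
  have "?w \<in> weyl_chamber_B"
    using k by (intro weyl_chamber_B_add weyl_chamber_B_scaleR \<phi>_B_in_weyl_chamber xch s w) auto
  from inner_interaction_le[OF \<xi> this]
  have A: "k\<^sub>2 * (\<Sum>i\<in>UNIV. (\<xi> $ i - ?w $ i) * ?A i) \<le> k\<^sub>2 * (real CARD('n))\<^sup>2"
    using k by (intro mult_left_mono) auto
  have D: "(\<Sum>i\<in>UNIV. (\<xi> $ i - sqrt k * ?p $ i - w $ i) * (k / \<xi> $ i - sqrt k / ?p $ i))
    \<le> (\<Sum>i\<in>UNIV. \<gamma>\<^sup>2 / (x $ i)\<^sup>2)"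
  proof (rule sum_mono)
    fix i
    have xi: "0 < x $ i" "0 < \<xi> $ i"
      by (fact interior_weyl_chamber_B(2)[OF x] interior_weyl_chamber_B(2)[OF \<xi>])+
    have pi: "?p $ i > 0" "(?p $ i)\<^sup>2 \<ge> (x $ i)\<^sup>2"
      using s xi by (auto simp: \<phi>_B_def add_nonneg_pos)
    have wi: "0 \<le> w $ i" "(w $ i)\<^sup>2 \<le> \<gamma>\<^sup>2"
      using w component_le_norm_cart[of w i] by (auto simp: weyl_chamber_B_def intro!: power_mono)
    have "(\<xi> $ i - sqrt k * ?p $ i - w $ i) * (k / \<xi> $ i - sqrt k / ?p $ i) \<le> (w $ i)\<^sup>2 / (?p $ i)\<^sup>2"
      by (rule reciprocal_term_le) (use k xi pi wi in auto)
    also have "\<dots> \<le> \<gamma>\<^sup>2 / (x $ i)\<^sup>2"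
      using wi pi xi by (intro frac_le) auto
    finally show "(\<xi> $ i - sqrt k * ?p $ i - w $ i) * (k / \<xi> $ i - sqrt k / ?p $ i) \<le> \<gamma>\<^sup>2 / (x $ i)\<^sup>2" .
  qed
  have "(bessel_drift_B k k\<^sub>2 \<xi> - (\<chi> i. sqrt k / ?p $ i)) \<bullet> (\<xi> - sqrt k *\<^sub>R ?p - w)
     = (\<Sum>i\<in>UNIV. k\<^sub>2 * ((\<xi> $ i - ?w $ i) * ?A i)
         + (\<xi> $ i - sqrt k * ?p $ i - w $ i) * (k / \<xi> $ i - sqrt k / ?p $ i))"
    unfolding inner_vec_def bessel_drift_B_def
    by (intro sum.cong refl) (simp, algebra)
  also have "\<dots> = k\<^sub>2 * (\<Sum>i\<in>UNIV. (\<xi> $ i - ?w $ i) * ?A i)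
     + (\<Sum>i\<in>UNIV. (\<xi> $ i - sqrt k * ?p $ i - w $ i) * (k / \<xi> $ i - sqrt k / ?p $ i))"
    by (simp add: sum.distrib sum_distrib_left)
  finally show ?thesis using A D by linarith
qed

section \<open>The deterministic limit curve\<close>

lemma continuous_on_\<phi>_B: "continuous_on A (\<lambda>t. \<phi>_B t x)"
  unfolding \<phi>_B_def by (intro continuous_on_vec_lambda continuous_intros)

lemma \<phi>_B_0:
  fixes x :: "real ^ 'n::{finite,linorder}"
  assumes "x \<in> interior weyl_chamber_B"
  shows "\<phi>_B 0 x = x"
  using interior_weyl_chamber_B(2)[OF assms] by (simp add: \<phi>_B_def vec_eq_iff less_imp_le)

text \<open>Each coordinate solves \<open>\<phi>' = 1 / \<phi>\<close>, and positivity of the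
  coordinates of \<open>x\<close> keeps the derivative continuous down to time 0. With
  \<open>c = sqrt k\<close> this is the integral equation of the centre subtracted from the Bessel
  path.\<close>

lemma \<phi>_B_integral:
  fixes x :: "real ^ 'n::{finite,linorder}"
  assumes x: "x \<in> interior weyl_chamber_B" and t: "0 \<le> t"
  shows "set_integrable lborel {0..t} (\<lambda>s. \<chi> i. c / \<phi>_B s x $ i)"
    and "(LINT s:{0..t}|lborel. \<chi> i. c / \<phi>_B s x $ i) = c *\<^sub>R \<phi>_B t x - c *\<^sub>R x"
proof -
  have pos: "0 < 2 * s + (x $ i)\<^sup>2" if "0 \<le> s" for s i
    using interior_weyl_chamber_B(2)[OF x, of i] that by (simp add: add_nonneg_pos)
  have cont: "continuous_on {0..t} (\<lambda>s. \<chi> i. c / \<phi>_B s x $ i)"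
  proof (intro continuous_on_vec_lambda)
    fix i
    have "2 * s + (x $ i)\<^sup>2 \<noteq> 0" if "s \<in> {0..t}" for s
      using pos[of s i] that by auto
    then show "continuous_on {0..t} (\<lambda>s. c / \<phi>_B s x $ i)"
      unfolding \<phi>_B_def by (auto intro!: continuous_intros)
  qed
  from cont show "set_integrable lborel {0..t} (\<lambda>s. \<chi> i. c / \<phi>_B s x $ i)"
    by (intro borel_integrable_atLeastAtMost') auto
  have "((\<lambda>s. c *\<^sub>R \<phi>_B s x) has_vector_derivative (\<chi> i. c / \<phi>_B s x $ i)) (at s within {0..t})"
    if "0 \<le> s" "s \<le> t" for s
  proof -
    have "((\<lambda>s. c * sqrt (2 * s + (x $ i)\<^sup>2)) has_real_derivative c / sqrt (2 * s + (x $ i)\<^sup>2))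
      (at s within {0..t})" for i
      using pos[OF that(1), of i] by (auto intro!: derivative_eq_intros simp: field_simps)
    then have der: "((\<lambda>s. c * sqrt (2 * s + (x $ i)\<^sup>2)) has_derivative
        (\<lambda>h. h * (c / sqrt (2 * s + (x $ i)\<^sup>2)))) (at s within {0..t})" for i
      by (simp only: has_field_derivative_def mult_commute_abs)
    show ?thesis
      unfolding has_vector_derivative_def
    proof (subst has_derivative_componentwise_within, rule ballI)
      fix e :: "real ^ 'n::{finite,linorder}" assume "e \<in> Basis"
      then obtain i where e: "e = axis i 1" by (auto simp: Basis_vec_def)
      show "((\<lambda>s. (c *\<^sub>R \<phi>_B s x) \<bullet> e) has_derivative
          (\<lambda>h. (h *\<^sub>R (\<chi> i. c / \<phi>_B s x $ i)) \<bullet> e)) (at s within {0..t})"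
        using der[of i] by (simp add: e inner_axis \<phi>_B_def)
    qed
  qed
  from integral_FTC_Icc[OF t this cont]
  show "(LINT s:{0..t}|lborel. \<chi> i. c / \<phi>_B s x $ i) = c *\<^sub>R \<phi>_B t x - c *\<^sub>R x"
    using interior_weyl_chamber_B(2)[OF x]
    by (simp add: set_lebesgue_integral_def \<phi>_B_0[OF x])
qed

section \<open>The pathwise deviation bound\<close>

text \<open>The constant is obtained before \<open>k\<close>, \<open>X\<close> and \<open>s\<close>:
  one bound serves all multiplicities driven by the same path \<open>b\<close>. This is what permits
  a supremum over uncountably many \<open>k\<close> later.\<close>

lemma bessel_path_deviation_bound:
  fixes x y :: "real ^ 'n::{finite,linorder}"
  assumes k2: "0 < k\<^sub>2" and x: "x \<in> interior weyl_chamber_B"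
    and b: "continuous_on {0..T} b" and T: "0 \<le> T"
  obtains C where "\<And>k X s. 0 < k \<Longrightarrow> bessel_path_B k k\<^sub>2 (sqrt k *\<^sub>R x + y) b X \<Longrightarrow> s \<in> {0..T} \<Longrightarrow>
      norm (X s - sqrt k *\<^sub>R \<phi>_B s x) \<le> C"
proof -
  have "bounded (b ` {0..T})"
    using b by (intro compact_imp_bounded compact_continuous_image) auto
  then obtain \<beta> where \<beta>: "\<And>s. s \<in> {0..T} \<Longrightarrow> norm (b s) \<le> \<beta>"
    unfolding bounded_iff by blast
  obtain R where R: "\<And>u. norm u \<le> \<beta> \<Longrightarrow> u + R *\<^sub>R x \<in> weyl_chamber_B"
    using bounded_plus_chamber[OF x] by metis
  define v where "v = R *\<^sub>R x"
  define \<gamma> where "\<gamma> = \<beta> + norm v"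
  define C where "C = k\<^sub>2 * (real CARD('n))\<^sup>2 + (\<Sum>i\<in>UNIV. \<gamma>\<^sup>2 / (x $ i)\<^sup>2)"
  have C0: "0 \<le> C" unfolding C_def using k2 by (intro add_nonneg_nonneg sum_nonneg) auto
  have \<gamma>: "norm (b s + v) \<le> \<gamma>" if "s \<in> {0..T}" for s
    using \<beta>[OF that] norm_triangle_ineq[of "b s" v] by (simp add: \<gamma>_def)
  have "norm (X s - sqrt k *\<^sub>R \<phi>_B s x) \<le> sqrt ((norm (y - v))\<^sup>2 + 2 * C * T) + \<gamma>"
    if k: "0 < k" and path: "bessel_path_B k k\<^sub>2 (sqrt k *\<^sub>R x + y) b X" and s: "s \<in> {0..T}" for k X s
  proof -
    note p = path[unfolded bessel_path_B_def]
    define g where "g u = bessel_drift_B k k\<^sub>2 (X u) - (\<chi> i. sqrt k / \<phi>_B u x $ i)" for u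
    define E where "E u = X u - sqrt k *\<^sub>R \<phi>_B u x - (b u + v)" for u
    have Xcont: "continuous_on {0..} X" using p by blast
    \<comment> \<open>The equation itself, read at time 0, forces this, because the drift integral
      over a single point vanishes.\<close>
    have b0: "b 0 = 0"
    proof -
      have "(LINT s:{0..0}|lborel. bessel_drift_B k k\<^sub>2 (X s)) = 0"
        unfolding set_lebesgue_integral_def
        by (rule integral_eq_zero_AE) (use AE_lborel_singleton[of 0] in \<open>eventually_elim; auto\<close>)
      then show ?thesis using p by (metis add.right_neutral add_cancel_right_right order_refl)
    qed
    have int: "set_integrable lborel {0..t} g" if "0 \<le> t" for t
      unfolding g_def using p that by (intro set_integral_diff \<phi>_B_integral x) auto
    \<comment> \<open>The starting point was chosen so that \<open>sqrt k *\<^sub>R x\<close>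
      cancels, which leaves an initial error independent of \<open>k\<close>.\<close>
    have E0: "E 0 = y - v" using p b0 by (simp add: E_def \<phi>_B_0[OF x])
    have Eint: "E t = E 0 + (LINT s:{0..t}|lborel. g s)" if "0 \<le> t" for t
    proof -
      have "(LINT s:{0..t}|lborel. g s) = (LINT s:{0..t}|lborel. bessel_drift_B k k\<^sub>2 (X s))
         - (sqrt k *\<^sub>R \<phi>_B t x - sqrt k *\<^sub>R x)"
        unfolding g_def \<phi>_B_integral(2)[OF x that, symmetric]
        using p that by (intro set_integral_diff \<phi>_B_integral x) auto
      moreover have "X t = X 0 + b t + (LINT s:{0..t}|lborel. bessel_drift_B k k\<^sub>2 (X s))" "X 0 = sqrt k *\<^sub>R x + y"
        using p that by blast+
      ultimately show ?thesis unfolding E0 by (simp add: E_def)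
    qed
    have "(norm (E s))\<^sup>2 \<le> (norm (E 0))\<^sup>2 + 2 * C * s"
    proof (rule norm_square_le_of_inner_deriv_le)
      show "continuous_on {0..s} E"
        unfolding E_def using s
        by (intro continuous_intros continuous_on_\<phi>_B continuous_on_subset[OF b]
            continuous_on_subset[OF Xcont]) auto
      have "AE u in lborel. 0 \<le> u \<longrightarrow> X u \<in> interior weyl_chamber_B" using p by blast
      then show "AE u in lborel. u \<in> {0..s} \<longrightarrow> g u \<bullet> E u \<le> C"
      proof eventually_elim
        case (elim u)
        show ?case
        proof
          assume u: "u \<in> {0..s}"
          then have u': "u \<in> {0..T}" using s by auto
          show "g u \<bullet> E u \<le> C"
            unfolding g_def E_def C_def
          proof (rule inner_bessel_drift_le[OF k k2 _ x _ _ \<gamma>[OF u']])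
            show "X u \<in> interior weyl_chamber_B" "0 \<le> u" using elim u by auto
            show "b u + v \<in> weyl_chamber_B" using R[OF \<beta>[OF u']] by (simp add: v_def)
          qed
        qed
      qed
      show "E t = E 0 + (LINT s:{0..t}|lborel. g s)" if "t \<in> {0..s}" for t
        using that by (intro Eint) simp
    qed (use s int in simp_all)
    also have "\<dots> \<le> (norm (y - v))\<^sup>2 + 2 * C * T"
      using E0 s C0 by (auto intro!: mult_left_mono)
    finally have "norm (E s) \<le> sqrt ((norm (y - v))\<^sup>2 + 2 * C * T)"
      using real_le_rsqrt by blast
    moreover have "X s - sqrt k *\<^sub>R \<phi>_B s x = E s + (b s + v)" by (simp add: E_def)
    ultimately show ?thesis
      using \<gamma>[OF s] norm_triangle_ineq[of "E s" "b s + v"] by simp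
  qed
  then show thesis by (rule that)
qed

section \<open>Almost sure continuity and measurability\<close>

lemma brownian_motion_continuous:
  fixes B :: "real \<Rightarrow> 'w \<Rightarrow> real ^ 'n"
  assumes "brownian_motion M B"
  shows "AE \<omega> in M. continuous_on {0..} (\<lambda>t. B t \<omega>)"
proof -
  have "AE \<omega> in M. \<forall>i\<in>UNIV. continuous_on {0..} (\<lambda>t. B t \<omega> $ i)"
    using assms by (intro AE_finite_allI) (auto simp: brownian_motion_def brownian_motion_1d_def)
  then show ?thesis
  proof eventually_elim
    case (elim \<omega>)
    then have "continuous_on {0..} (\<lambda>t. \<chi> i. B t \<omega> $ i)"
      by (intro continuous_on_vec_lambda) auto
    then show ?case by simp
  qed
qed

text \<open>The filtration is generated by preimages under the measurable \<open>B s\<close> and by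
  null sets of the completion, all of which lie in the completed sigma-algebra. This makes the
  values of the adapted processes measurable there.\<close>

lemma augmented_filtration_measurable_completion:
  fixes B :: "real \<Rightarrow> 'w \<Rightarrow> real ^ 'n"
  assumes B: "brownian_motion M B" and t: "0 \<le> t"
    and f: "f \<in> borel_measurable (augmented_filtration M B t)"
  shows "f \<in> borel_measurable (completion M)"
proof -
  let ?G = "(\<Union>s\<in>{0..t}. sets (vimage_algebra (space M) (B s) borel)) \<union> null_sets (completion M)"
  have Bm: "B s \<in> borel_measurable M" if "0 \<le> s" for s
  proof -
    have "(\<lambda>\<omega>. B s \<omega> $ i) \<in> borel_measurable M" for i
      using B that by (auto simp: brownian_motion_def brownian_motion_1d_def)
    then show ?thesis
      by (subst borel_measurable_euclidean_space) (auto simp: Basis_vec_def inner_axis)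
  qed
  have "?G \<subseteq> sets (completion M)"
  proof
    fix A assume "A \<in> ?G"
    then consider s where "0 \<le> s" "A \<in> sets (vimage_algebra (space M) (B s) borel)"
      | "A \<in> null_sets (completion M)" by auto
    then show "A \<in> sets (completion M)"
    proof cases
      case 1
      then obtain S where "S \<in> sets borel" "A = B s -` S \<inter> space M"
        by (auto simp: sets_vimage_algebra2)
      then have "A \<in> sets M" using Bm[OF 1(1)] by (auto intro: measurable_sets)
      then show ?thesis by auto
    qed auto
  qed
  moreover from this have sp: "?G \<subseteq> Pow (space M)"
    using sets.sets_into_space[of _ "completion M"] by auto
  ultimately have "sets (augmented_filtration M B t) \<subseteq> sets (completion M)"
    unfolding augmented_filtration_def
    using sets.sigma_sets_subset[of ?G "completion M"] by (simp add: sets_measure_of)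
  moreover have "space (augmented_filtration M B t) = space (completion M)"
    using sp by (simp add: augmented_filtration_def space_measure_of)
  ultimately show ?thesis
    using measurable_sets[OF f] by (intro measurableI) auto
qed

section \<open>From the pathwise bound to the probabilistic statements\<close>

theorem theorem3p7:
  fixes M :: "'w measure"
    and B :: "real \<Rightarrow> 'w \<Rightarrow> real ^ ('n::{finite,linorder})"
    and X :: "real \<Rightarrow> real \<Rightarrow> 'w \<Rightarrow> real ^ ('n::{finite,linorder})"
    and x y :: "real ^ ('n::{finite,linorder})"
    and k\<^sub>0 k\<^sub>2 :: real
  assumes "prob_space M"
    and "brownian_motion M B"
    and "0 < k\<^sub>2"
    and "x \<in> interior weyl_chamber_B"
    and "1 / 2 \<le> k\<^sub>0"
    and "\<forall>k\<^sub>1\<ge>k\<^sub>0. sqrt k\<^sub>1 *\<^sub>R x + y \<in> interior weyl_chamber_B"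
    and "bessel_family_B M B k\<^sub>2 {k\<^sub>0..} (\<lambda>k\<^sub>1. sqrt k\<^sub>1 *\<^sub>R x + y) X"
  shows "(\<forall>t>0. AE \<omega> in M.
            (SUP (s, k\<^sub>1)\<in>{0..t} \<times> {k\<^sub>0..}. ereal (norm (X k\<^sub>1 s \<omega> - sqrt k\<^sub>1 *\<^sub>R \<phi>_B s x))) < \<infinity>) \<and>
         (AE \<omega> in M. \<forall>T>0.
            uniform_limit {0..T} (\<lambda>k\<^sub>1 t. X k\<^sub>1 t \<omega> /\<^sub>R sqrt k\<^sub>1) (\<lambda>t. \<phi>_B t x) at_top) \<and>
         locally_uniformly_in_prob M (\<lambda>k\<^sub>1 t \<omega>. X k\<^sub>1 t \<omega> /\<^sub>R sqrt k\<^sub>1) (\<lambda>t. \<phi>_B t x)"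
proof -
  interpret prob_space M by fact
  define Y where "Y k s \<omega> = X k s \<omega> /\<^sub>R sqrt k" for k s \<omega>
  have path: "AE \<omega> in M. \<forall>k\<in>{k\<^sub>0..}. bessel_path_B k k\<^sub>2 (sqrt k *\<^sub>R x + y) (\<lambda>t. B t \<omega>) (\<lambda>t. X k t \<omega>)"
    using assms(7) unfolding bessel_family_B_def by blast
  \<comment> \<open>All quantifiers over \<open>T\<close>, \<open>k\<close> and \<open>s\<close>
    stand inside the almost sure statement: the exceptional set comes only from the common null set
    of the equations and from the continuity of \<open>B\<close>.\<close>
  have bound: "AE \<omega> in M. \<forall>T\<ge>0. \<exists>C. \<forall>k\<ge>k\<^sub>0. \<forall>s\<in>{0..T}. norm (X k s \<omega> - sqrt k *\<^sub>R \<phi>_B s x) \<le> C"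
    using path brownian_motion_continuous[OF assms(2)]
  proof eventually_elim
    case (elim \<omega>)
    show ?case
    proof (intro allI impI)
      fix T :: real assume T: "0 \<le> T"
      have "continuous_on {0..T} (\<lambda>t. B t \<omega>)"
        using elim(2) by (rule continuous_on_subset) auto
      from bessel_path_deviation_bound[OF assms(3,4) this T, where y = y]
      obtain C where C: "\<And>k X s. 0 < k \<Longrightarrow> bessel_path_B k k\<^sub>2 (sqrt k *\<^sub>R x + y) (\<lambda>t. B t \<omega>) X \<Longrightarrow> 
        s \<in> {0..T} \<Longrightarrow> norm (X s - sqrt k *\<^sub>R \<phi>_B s x) \<le> C"
        by metis
      have "norm (X k s \<omega> - sqrt k *\<^sub>R \<phi>_B s x) \<le> C" if "k \<ge> k\<^sub>0" "s \<in> {0..T}" for k s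
        using C[of k "\<lambda>t. X k t \<omega>" s] elim(1) assms(5) that by auto
      then show "\<exists>C. \<forall>k\<ge>k\<^sub>0. \<forall>s\<in>{0..T}. norm (X k s \<omega> - sqrt k *\<^sub>R \<phi>_B s x) \<le> C"
        by blast
    qed
  qed
  have part1: "AE \<omega> in M.
      (SUP (s, k\<^sub>1)\<in>{0..t} \<times> {k\<^sub>0..}. ereal (norm (X k\<^sub>1 s \<omega> - sqrt k\<^sub>1 *\<^sub>R \<phi>_B s x))) < \<infinity>"
    if "t > 0" for t
    using bound
  proof eventually_elim
    case (elim \<omega>)
    then obtain C where "\<And>k s. k \<ge> k\<^sub>0 \<Longrightarrow> s \<in> {0..t} \<Longrightarrow> norm (X k s \<omega> - sqrt k *\<^sub>R \<phi>_B s x) \<le> C"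
      using \<open>t > 0\<close> by (metis less_imp_le)
    then have "(SUP (s, k\<^sub>1)\<in>{0..t} \<times> {k\<^sub>0..}. ereal (norm (X k\<^sub>1 s \<omega> - sqrt k\<^sub>1 *\<^sub>R \<phi>_B s x))) \<le> ereal C"
      by (intro SUP_least) auto
    then show ?case by (rule order.strict_trans1) simp
  qed
  have part2: "AE \<omega> in M. \<forall>T>0. uniform_limit {0..T} (\<lambda>k t. Y k t \<omega>) (\<lambda>t. \<phi>_B t x) at_top"
    using bound
  proof eventually_elim
    case (elim \<omega>)
    show ?case
    proof (intro allI impI)
      fix T :: real assume "T > 0"
      then obtain C where C: "\<And>k s. k \<ge> k\<^sub>0 \<Longrightarrow> s \<in> {0..T} \<Longrightarrow> norm (X k s \<omega> - sqrt k *\<^sub>R \<phi>_B s x) \<le> C"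
        using elim by (metis less_imp_le)
      \<comment> \<open>Dividing the uniform bound by \<open>sqrt k\<close> gives the rate
        \<open>C / sqrt k\<close>, uniformly on \<open>{0..T}\<close>.\<close>
      have lim: "((\<lambda>k. C / sqrt k) \<longlongrightarrow> 0) at_top"
        by (intro tendsto_divide_0[OF tendsto_const] filterlim_at_top_imp_at_infinity sqrt_at_top)
      show "uniform_limit {0..T} (\<lambda>k t. Y k t \<omega>) (\<lambda>t. \<phi>_B t x) at_top"
      proof (rule uniform_limitI)
        fix e :: real assume "e > 0"
        have "\<forall>\<^sub>F k in at_top. C / sqrt k < e" using order_tendstoD(2)[OF lim \<open>e > 0\<close>] .
        then show "\<forall>\<^sub>F k in at_top. \<forall>s\<in>{0..T}. dist (Y k s \<omega>) (\<phi>_B s x) < e"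
          using eventually_ge_at_top[of k\<^sub>0]
        proof eventually_elim
          case (elim k)
          then have k: "sqrt k > 0" using assms(5) by simp
          show ?case
          proof
            fix s assume "s \<in> {0..T}"
            have "dist (Y k s \<omega>) (\<phi>_B s x) = norm ((1 / sqrt k) *\<^sub>R (X k s \<omega> - sqrt k *\<^sub>R \<phi>_B s x))"
              using k by (simp add: Y_def dist_norm scaleR_diff_right divide_inverse)
            also have "\<dots> = norm (X k s \<omega> - sqrt k *\<^sub>R \<phi>_B s x) / sqrt k"
              using k by simp
            also have "\<dots> \<le> C / sqrt k"
              using C[OF elim(2) \<open>s \<in> _\<close>] k by (intro divide_right_mono) auto
            finally show "dist (Y k s \<omega>) (\<phi>_B s x) < e" using elim(1) by simp
          qed
        qed
      qed
    qed
  qed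
  have part3: "locally_uniformly_in_prob M Y (\<lambda>t. \<phi>_B t x)"
  proof -
    have "(\<forall>\<^sub>F k in at_top. D k \<in> sets (completion M)) \<and> ((\<lambda>k. measure (completion M) (D k)) \<longlongrightarrow> 0) at_top"
      if T: "0 < T" and e: "0 < \<epsilon>"
        and D_def: "\<And>k. D k = {\<omega> \<in> space M. (SUP s\<in>{0..T}. ereal (norm (Y k s \<omega> - \<phi>_B s x))) > ereal \<epsilon>}"
      for T \<epsilon> D
    proof -
      have D: "D k = {\<omega> \<in> space M. \<exists>s\<in>{0..T}. \<epsilon> < norm (Y k s \<omega> - \<phi>_B s x)}" for k
        unfolding D_def by (auto simp: less_SUP_iff)
      obtain Q where Q: "countable Q" "Q \<subseteq> {0..T}" "{0..T} \<subseteq> closure Q"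
        using separable by metis
      have Ds: "D k \<in> sets (completion M)" if k: "k \<ge> k\<^sub>0" for k
      proof -
        \<comment> \<open>Restricting time to a countable dense set gives a measurable event. By
          continuity of the paths it agrees with \<open>D k\<close> outside a null set, and
          completeness then carries measurability over to \<open>D k\<close>.\<close>
        define D' where "D' = {\<omega> \<in> space (completion M). \<exists>s\<in>Q. \<epsilon> < norm (Y k s \<omega> - \<phi>_B s x)}"
        have meas: "(\<lambda>\<omega>. Y k s \<omega>) \<in> borel_measurable (completion M)" if "s \<in> Q" for s
          using augmented_filtration_measurable_completion[OF assms(2), of s "X k s"] assms(7) k that Q(2)
          unfolding Y_def bessel_family_B_def by auto
        have D': "D' \<in> sets (completion M)"
          unfolding D'_def using meas
          by (intro sets.sets_Collect_countable_Ex'[OF _ Q(1)]) measurable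
        have "AE \<omega> in M. \<omega> \<in> D k \<longleftrightarrow> \<omega> \<in> D'"
          using path AE_space
        proof eventually_elim
          case (elim \<omega>)
          have "continuous_on {0..} (\<lambda>s. X k s \<omega>)"
            using elim(1) k unfolding bessel_path_B_def by auto
          then have cont: "continuous_on {0..T} (\<lambda>s. norm (Y k s \<omega> - \<phi>_B s x))"
            unfolding Y_def
            by (intro continuous_intros continuous_on_\<phi>_B) (auto intro: continuous_on_subset)
          show ?case
          proof
            assume "\<omega> \<in> D'" then show "\<omega> \<in> D k" using Q(2) by (auto simp: D'_def D)
          next
            assume "\<omega> \<in> D k"
            then obtain s where s: "s \<in> {0..T}" "\<epsilon> < norm (Y k s \<omega> - \<phi>_B s x)"
              by (auto simp: D)
            have "\<not> (\<forall>q\<in>Q. norm (Y k q \<omega> - \<phi>_B q x) \<le> \<epsilon>)"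
            proof
              assume le: "\<forall>q\<in>Q. norm (Y k q \<omega> - \<phi>_B q x) \<le> \<epsilon>"
              have "closure Q \<subseteq> {0..T}" using Q(2) by (simp add: closure_minimal)
              then have "norm (Y k s \<omega> - \<phi>_B s x) \<le> \<epsilon>"
                using continuous_le_on_closure[of Q "\<lambda>s. norm (Y k s \<omega> - \<phi>_B s x)" s \<epsilon>] le s(1) Q(3)
                  continuous_on_subset[OF cont] by blast
              then show False using s(2) by simp
            qed
            then show "\<omega> \<in> D'" using elim(2) by (auto simp: D'_def not_le)
          qed
        qed
        then have "AE \<omega> in completion M. \<omega> \<in> D k \<longleftrightarrow> \<omega> \<in> D'"
          by (rule AE_completion)
        then have N: "{\<omega> \<in> space M. \<not> (\<omega> \<in> D k \<longleftrightarrow> \<omega> \<in> D')} \<in> null_sets (completion M)" (is "?N \<in> _")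
          by (simp add: completion.AE_iff_null_sets)
        then have "D k \<inter> ?N \<in> null_sets (completion M)"
          by (rule completion.complete2[OF Int_lower2])
        then have "(D' - ?N) \<union> (D k \<inter> ?N) \<in> sets (completion M)"
          using D' N by blast
        moreover have "D k = (D' - ?N) \<union> (D k \<inter> ?N)"
          by (auto simp: D'_def D)
        ultimately show ?thesis by simp
      qed
      interpret c: prob_space "completion M" by (rule prob_space_completion)
      \<comment> \<open>Dominated convergence asks for measurability at every real \<open>k\<close>,
        whereas nothing is known about \<open>X k\<close> below \<open>k\<^sub>0\<close>. The events
        are set to be empty there, which does not affect the limit.\<close>
      define F where "F k = (if k \<ge> k\<^sub>0 then D k else {})" for k
      have Fs: "F k \<in> sets (completion M)" for k using Ds by (auto simp: F_def)
      have "((\<lambda>k. \<integral>\<omega>. indicat_real (F k) \<omega> \<partial>completion M) \<longlongrightarrow> (\<integral>\<omega>. 0 \<partial>completion M)) at_top"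
      proof (rule integral_dominated_convergence_at_top[where w = "\<lambda>_. 1 :: real"])
        show "AE \<omega> in completion M. ((\<lambda>k. indicator (F k) \<omega> :: real) \<longlongrightarrow> 0) at_top"
        proof (rule AE_completion)
          show "AE \<omega> in M. ((\<lambda>k. indicator (F k) \<omega> :: real) \<longlongrightarrow> 0) at_top"
            using part2
          proof eventually_elim
            case (elim \<omega>)
            \<comment> \<open>For a fixed outcome, uniform convergence excludes it from all events
              with large \<open>k\<close>, so the indicators are eventually 0.\<close>
            then have "\<forall>\<^sub>F k in at_top. \<forall>s\<in>{0..T}. dist (Y k s \<omega>) (\<phi>_B s x) < \<epsilon>"
              using uniform_limitD[OF _ e] T by blast
            then have "\<forall>\<^sub>F k in at_top. indicator (F k) \<omega> = (0 :: real)"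
              by eventually_elim (force simp: F_def D dist_norm indicator_def)
            then show ?case by (rule tendsto_eventually)
          qed
        qed
      qed (use Fs in auto)
      then have "((\<lambda>k. measure (completion M) (F k)) \<longlongrightarrow> 0) at_top"
        using Fs sets.Int_space_eq2[OF Fs] by simp
      moreover have "\<forall>\<^sub>F k in at_top. measure (completion M) (F k) = measure (completion M) (D k)"
        using eventually_ge_at_top[of k\<^sub>0] by eventually_elim (simp add: F_def)
      ultimately have lim: "((\<lambda>k. measure (completion M) (D k)) \<longlongrightarrow> 0) at_top"
        by (rule Lim_transform_eventually)
      have "\<forall>\<^sub>F k in at_top. D k \<in> sets (completion M)"
        using eventually_ge_at_top[of k\<^sub>0] by eventually_elim (rule Ds)
      with lim show ?thesis by simp
    qed
    then show ?thesis by (simp add: locally_uniformly_in_prob_def Let_def)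
  qed
  show ?thesis
    by (intro conjI allI impI part1 part2[unfolded Y_def] part3[unfolded Y_def])
qed

end
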